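(* If $m(w,\gamma)$ is linear in $\gamma$ and there is $\alpha_0(x)$ such that $E[\alpha_0(X)^2]<\infty$ and $E[m(W,\gamma)]=E[\alpha_0(X)\gamma(X)]$ for all $\gamma$ with $E[\gamma(X)^2]<\infty$, then $$\psi(w,\gamma,\alpha,\theta)=m(w,\gamma)-\theta+\alpha(x)[y-\gamma(x)]$$ is doubly robust.
   Context: $W$ is a data observation that includes an outcome variable $Y$ and regressors $X$. $\gamma_0(X)=E[Y|X]$, and $\theta_0=E[m(W,\gamma_0)]$, where $m(w,\gamma)$ is a functional of a function $\gamma$ of $x$. With $\bar\psi(\gamma,\alpha,\theta)=E[\psi(W,\gamma,\alpha,\theta)]$, the moment function $\psi$ is doubly robust if $0=\bar\psi(\gamma,\alpha_0,\theta_0)=\bar\psi(\gamma_0,\alpha,\theta_0)$ for all $\gamma\in\Gamma$ and all $\alpha$. Here $\Gamma$ is the set of possible first steps, in this result the functions $\gamma(x)$ with $E[\gamma(X)^2]<\infty$. *)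

theory Defs
  imports "HOL-Probability.Probability"
begin

definition square_integrable_functions ::
  "'a measure \<Rightarrow> 'x measure \<Rightarrow> ('a \<Rightarrow> 'x) \<Rightarrow> ('x \<Rightarrow> real) set" where
  "square_integrable_functions M S X =
     {\<gamma> \<in> borel_measurable S. integrable M (\<lambda>\<omega>. (\<gamma> (X \<omega>))\<^sup>2)}"

text \<open>\<open>\<gamma>\<close> is a version of the regression function: \<open>\<gamma>(X) = E[Y|X]\<close> almost surely, the conditioning
  being on the sigma-algebra generated by \<open>X\<close>.\<close>

definition is_regression_function ::
  "'a measure \<Rightarrow> 'x measure \<Rightarrow> ('a \<Rightarrow> 'x) \<Rightarrow> ('a \<Rightarrow> real) \<Rightarrow> ('x \<Rightarrow> real) \<Rightarrow> bool" where
  "is_regression_function M S X Y \<gamma> \<longleftrightarrow>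
     \<gamma> \<in> borel_measurable S \<and> integrable M Y \<and>
     (AE \<omega> in M. \<gamma> (X \<omega>) = real_cond_exp M (vimage_algebra (space M) X S) Y \<omega>)"

definition linear_functional_on :: "('x \<Rightarrow> real) set \<Rightarrow> (('x \<Rightarrow> real) \<Rightarrow> real) \<Rightarrow> bool" where
  "linear_functional_on \<Gamma> L \<longleftrightarrow>
     (\<forall>\<gamma>\<in>\<Gamma>. \<forall>\<delta>\<in>\<Gamma>. L (\<lambda>x. \<gamma> x + \<delta> x) = L \<gamma> + L \<delta>) \<and>
     (\<forall>c. \<forall>\<gamma>\<in>\<Gamma>. L (\<lambda>x. c * \<gamma> x) = c * L \<gamma>)"

type_synonym ('w, 'x) moment_function =
  "'w \<Rightarrow> ('x \<Rightarrow> real) \<Rightarrow> ('x \<Rightarrow> real) \<Rightarrow> real \<Rightarrow> real"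

definition moment_exists ::
  "'a measure \<Rightarrow> ('a \<Rightarrow> 'w) \<Rightarrow> ('w, 'x) moment_function \<Rightarrow>
   ('x \<Rightarrow> real) \<Rightarrow> ('x \<Rightarrow> real) \<Rightarrow> real \<Rightarrow> bool" where
  "moment_exists M W \<psi> \<gamma> \<alpha> \<theta> \<longleftrightarrow> integrable M (\<lambda>\<omega>. \<psi> (W \<omega>) \<gamma> \<alpha> \<theta>)"

definition mean_moment ::
  "'a measure \<Rightarrow> ('a \<Rightarrow> 'w) \<Rightarrow> ('w, 'x) moment_function \<Rightarrow>
   ('x \<Rightarrow> real) \<Rightarrow> ('x \<Rightarrow> real) \<Rightarrow> real \<Rightarrow> real" where
  "mean_moment M W \<psi> \<gamma> \<alpha> \<theta> = (LINT \<omega>|M. \<psi> (W \<omega>) \<gamma> \<alpha> \<theta>)"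

text \<open>The Bochner integral of a non-integrable function is \<open>0\<close>, so existence of the moments is
  tracked explicitly. Along \<open>\<Gamma>\<close> existence is part of the property. ``All \<open>\<alpha>\<close>'' means all measurable
  \<open>\<alpha>\<close> for which the moment at \<open>\<gamma>0\<close> exists; for the moment function below this includes every
  square-integrable \<open>\<alpha>(X)\<close> as soon as \<open>E[Y\<^sup>2] < \<infinity>\<close>, and every bounded \<open>\<alpha>\<close> in any case.\<close>

definition doubly_robust ::
  "'a measure \<Rightarrow> 'x measure \<Rightarrow> ('a \<Rightarrow> 'w) \<Rightarrow> ('x \<Rightarrow> real) set \<Rightarrow> ('w, 'x) moment_function \<Rightarrow>
   ('x \<Rightarrow> real) \<Rightarrow> ('x \<Rightarrow> real) \<Rightarrow> real \<Rightarrow> bool" where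
  "doubly_robust M S W \<Gamma> \<psi> \<gamma>0 \<alpha>0 \<theta>0 \<longleftrightarrow>
     (\<forall>\<gamma>\<in>\<Gamma>. moment_exists M W \<psi> \<gamma> \<alpha>0 \<theta>0 \<and> mean_moment M W \<psi> \<gamma> \<alpha>0 \<theta>0 = 0) \<and>
     (\<forall>\<alpha>\<in>borel_measurable S. moment_exists M W \<psi> \<gamma>0 \<alpha> \<theta>0 \<longrightarrow> mean_moment M W \<psi> \<gamma>0 \<alpha> \<theta>0 = 0)"

text \<open>The observation \<open>w\<close> contains the outcome \<open>yc w\<close> and the regressors \<open>xc w\<close>.\<close>

definition debiased_moment ::
  "('w \<Rightarrow> ('x \<Rightarrow> real) \<Rightarrow> real) \<Rightarrow> ('w \<Rightarrow> real) \<Rightarrow> ('w \<Rightarrow> 'x) \<Rightarrow> ('w, 'x) moment_function" where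
  "debiased_moment m yc xc w \<gamma> \<alpha> \<theta> = m w \<gamma> - \<theta> + \<alpha> (xc w) * (yc w - \<gamma> (xc w))"

end

theory Submission
  imports Defs
begin

text \<open>The regression residual \<open>Y - \<gamma>0(X)\<close> has conditional mean zero given \<open>X\<close>, so it is orthogonal to
  every function of \<open>X\<close>, which makes the moment at \<open>\<gamma>0\<close> vanish for every \<open>\<alpha>\<close>. At \<open>\<alpha>0\<close>, linearity of the
  Riesz pairing gives \<open>E[m(W,\<gamma>)] - \<theta>0 = E[\<alpha>0(X) (\<gamma>(X) - \<gamma>0(X))]\<close>, and this cancels against
  \<open>E[\<alpha>0(X) (Y - \<gamma>(X))] = E[\<alpha>0(X) (\<gamma>0(X) - \<gamma>(X))]\<close>.\<close>

text \<open>The dominating function comes from \<bar>a b\<bar> \<le> 2 \<bar>a\<bar> \<bar>b\<bar>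
  \<le> a^2 + b^2. It makes the Riesz pairing of \<open>\<alpha>0\<close> with members of
  \<open>\<Gamma>\<close> finite.\<close>

lemma integrable_mult_of_square_integrable:
  fixes f g :: "'a \<Rightarrow> real"
  assumes [measurable]: "f \<in> borel_measurable M" "g \<in> borel_measurable M"
    and "integrable M (\<lambda>x. (f x)\<^sup>2)" "integrable M (\<lambda>x. (g x)\<^sup>2)"
  shows "integrable M (\<lambda>x. f x * g x)"
proof (rule Bochner_Integration.integrable_bound)
  show "integrable M (\<lambda>x. (f x)\<^sup>2 + (g x)\<^sup>2)"
    using assms by simp
  have "\<bar>a * b\<bar> \<le> a\<^sup>2 + b\<^sup>2" for a b :: real
  proof -
    have "2 * (\<bar>a\<bar> * \<bar>b\<bar>) \<le> a\<^sup>2 + b\<^sup>2"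
      using sum_squares_bound[of "\<bar>a\<bar>" "\<bar>b\<bar>"] by simp
    moreover have "0 \<le> \<bar>a\<bar> * \<bar>b\<bar>" by simp
    ultimately show ?thesis unfolding abs_mult by linarith
  qed
  then show "AE x in M. norm (f x * g x) \<le> norm ((f x)\<^sup>2 + (g x)\<^sup>2)"
    by (intro AE_I2) simp
qed measurable

lemma integrable_mult_square_integrable_functions:
  assumes "X \<in> M \<rightarrow>\<^sub>M S"
    and "f \<in> square_integrable_functions M S X" "g \<in> square_integrable_functions M S X"
  shows "integrable M (\<lambda>\<omega>. f (X \<omega>) * g (X \<omega>))"
  using assms unfolding square_integrable_functions_def
  by (intro integrable_mult_of_square_integrable) (auto intro: measurable_compose)

text \<open>Only the product is assumed integrable: \<open>\<alpha>(X) Y\<close> and \<open>\<alpha>(X) \<gamma>(X)\<close> need not be so separately, hence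
  the conditional expectation is taken of the residual.\<close>

lemma regression_residual_orthogonal:
  fixes Y :: "'a \<Rightarrow> real"
  assumes "prob_space M" and X: "X \<in> M \<rightarrow>\<^sub>M S"
    and reg: "is_regression_function M S X Y \<gamma>"
    and \<alpha>: "\<alpha> \<in> borel_measurable S"
    and int: "integrable M (\<lambda>\<omega>. \<alpha> (X \<omega>) * (Y \<omega> - \<gamma> (X \<omega>)))"
  shows "(LINT \<omega>|M. \<alpha> (X \<omega>) * (Y \<omega> - \<gamma> (X \<omega>))) = 0"
proof -
  define F where "F = vimage_algebra (space M) X S"
  interpret prob_space M by fact
  have subalg: "subalgebra M F"
    unfolding subalgebra_def F_def using X
    by (auto simp: sets_vimage_algebra2[OF measurable_space[OF X, THEN Pi_I]] intro: measurable_sets)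
  \<comment> \<open>The rules for \<open>real_cond_exp\<close> need \<open>M\<close> restricted to
    \<open>F\<close> to be sigma-finite; finiteness of \<open>M\<close> supplies this.\<close>
  interpret finite_measure_subalgebra M F
    using subalg by unfold_locales
  have XF: "X \<in> F \<rightarrow>\<^sub>M S"
    unfolding F_def by (rule measurable_vimage_algebra1) (use measurable_space[OF X] in auto)
  have \<gamma>: "\<gamma> \<in> borel_measurable S" and intY: "integrable M Y"
    and ce: "AE \<omega> in M. \<gamma> (X \<omega>) = real_cond_exp M F Y \<omega>"
    using reg unfolding is_regression_function_def F_def by auto
  have \<gamma>F: "(\<lambda>\<omega>. \<gamma> (X \<omega>)) \<in> borel_measurable F"
    and \<alpha>F: "(\<lambda>\<omega>. \<alpha> (X \<omega>)) \<in> borel_measurable F"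
    using XF \<gamma> \<alpha> by (auto intro: measurable_compose)
  have \<gamma>M: "(\<lambda>\<omega>. \<gamma> (X \<omega>)) \<in> borel_measurable M"
    using X \<gamma> by (rule measurable_compose)
  \<comment> \<open>Integrability is inherited from \<open>Y\<close> through its conditional
    expectation, so square integrability of \<gamma>(X) is not called upon.\<close>
  have int\<gamma>: "integrable M (\<lambda>\<omega>. \<gamma> (X \<omega>))"
    using integrable_cong_AE_imp[OF real_cond_exp_int(1)[OF intY] \<gamma>M] ce
    by (simp add: eq_commute)
  \<comment> \<open>Being \<open>F\<close>-measurable, \<gamma>(X) is its own conditional
    expectation, and it agrees almost surely with that of \<open>Y\<close>.\<close>
  have "AE \<omega> in M. real_cond_exp M F (\<lambda>\<omega>. Y \<omega> - \<gamma> (X \<omega>)) \<omega> = 0"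
    using real_cond_exp_diff[OF intY int\<gamma>] real_cond_exp_F_meas[OF int\<gamma> \<gamma>F] ce by auto
  then have zero: "AE \<omega> in M. \<alpha> (X \<omega>) * real_cond_exp M F (\<lambda>\<omega>. Y \<omega> - \<gamma> (X \<omega>)) \<omega> = 0"
    by auto
  \<comment> \<open>The \<open>F\<close>-measurable factor \<alpha>(X) is pulled out; this rule asks
    for integrability of the product only.\<close>
  have "(LINT \<omega>|M. \<alpha> (X \<omega>) * (Y \<omega> - \<gamma> (X \<omega>)))
      = (LINT \<omega>|M. \<alpha> (X \<omega>) * real_cond_exp M F (\<lambda>\<omega>. Y \<omega> - \<gamma> (X \<omega>)) \<omega>)"
    using real_cond_exp_intg(2)[OF int \<alpha>F] intY \<gamma>M by auto
  also have "\<dots> = 0"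
    using integral_eq_zero_AE[OF zero] .
  finally show ?thesis .
qed

theorem corollary9:
  fixes M :: "'a measure" and N :: "'w measure" and S :: "'x measure"
    and W :: "'a \<Rightarrow> 'w" and yc :: "'w \<Rightarrow> real" and xc :: "'w \<Rightarrow> 'x"
    and Y :: "'a \<Rightarrow> real" and X :: "'a \<Rightarrow> 'x"
    and m :: "'w \<Rightarrow> ('x \<Rightarrow> real) \<Rightarrow> real"
    and \<Gamma> :: "('x \<Rightarrow> real) set"
    and \<gamma>0 \<alpha>0 :: "'x \<Rightarrow> real" and \<theta>0 :: real
  assumes "prob_space M"
    and "W \<in> M \<rightarrow>\<^sub>M N" and "yc \<in> borel_measurable N" and "xc \<in> N \<rightarrow>\<^sub>M S"
    and "Y = (\<lambda>\<omega>. yc (W \<omega>))" and "X = (\<lambda>\<omega>. xc (W \<omega>))"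
    and "\<Gamma> = square_integrable_functions M S X"
    and "is_regression_function M S X Y \<gamma>0" and "\<gamma>0 \<in> \<Gamma>"
    and "\<And>w. w \<in> space N \<Longrightarrow> linear_functional_on \<Gamma> (m w)"
    and "\<And>\<gamma>. \<gamma> \<in> \<Gamma> \<Longrightarrow> integrable M (\<lambda>\<omega>. m (W \<omega>) \<gamma>)"
    and "\<theta>0 = (LINT \<omega>|M. m (W \<omega>) \<gamma>0)"
    and "\<alpha>0 \<in> square_integrable_functions M S X"
    and "\<And>\<gamma>. \<gamma> \<in> \<Gamma> \<Longrightarrow> (LINT \<omega>|M. m (W \<omega>) \<gamma>) = (LINT \<omega>|M. \<alpha>0 (X \<omega>) * \<gamma> (X \<omega>))"
    and "integrable M (\<lambda>\<omega>. \<alpha>0 (X \<omega>) * Y \<omega>)"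
  shows "doubly_robust M S W \<Gamma> (debiased_moment m yc xc) \<gamma>0 \<alpha>0 \<theta>0"
proof -
  note \<Gamma> = \<open>\<Gamma> = square_integrable_functions M S X\<close>
  interpret prob_space M by fact
  have X: "X \<in> M \<rightarrow>\<^sub>M S"
    using assms(2,4,6) by simp
  have \<alpha>0: "\<alpha>0 \<in> borel_measurable S"
    using assms(13) by (simp add: square_integrable_functions_def)
  note orth = regression_residual_orthogonal[OF \<open>prob_space M\<close> X assms(8)]
  have \<alpha>0\<gamma>: "integrable M (\<lambda>\<omega>. \<alpha>0 (X \<omega>) * \<gamma> (X \<omega>))" if "\<gamma> \<in> \<Gamma>" for \<gamma>
    using integrable_mult_square_integrable_functions[OF X assms(13)] that \<Gamma> by simp
  have \<psi>: "debiased_moment m yc xc (W \<omega>) \<gamma> \<alpha> \<theta>0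
      = m (W \<omega>) \<gamma> - \<theta>0 + \<alpha> (X \<omega>) * (Y \<omega> - \<gamma> (X \<omega>))" for \<omega> \<gamma> \<alpha>
    by (simp add: debiased_moment_def assms(5,6))
  show ?thesis
    unfolding doubly_robust_def moment_exists_def mean_moment_def \<psi>
  proof (intro conjI ballI impI)
    fix \<gamma> assume \<gamma>: "\<gamma> \<in> \<Gamma>"
    \<comment> \<open>Integrability of \<alpha>0(X) Y permits splitting the product here. The facts
      are kept general in \<gamma>' because they are used both at \<gamma> and at \<gamma>0.\<close>
    have int: "integrable M (\<lambda>\<omega>. \<alpha>0 (X \<omega>) * (Y \<omega> - \<gamma>' (X \<omega>)))"
      and eq: "(LINT \<omega>|M. \<alpha>0 (X \<omega>) * (Y \<omega> - \<gamma>' (X \<omega>)))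
        = (LINT \<omega>|M. \<alpha>0 (X \<omega>) * Y \<omega>) - (LINT \<omega>|M. \<alpha>0 (X \<omega>) * \<gamma>' (X \<omega>))"
      if "\<gamma>' \<in> \<Gamma>" for \<gamma>'
      using assms(15) \<alpha>0\<gamma>[OF that] by (simp_all add: right_diff_distrib)
    show "integrable M (\<lambda>\<omega>. m (W \<omega>) \<gamma> - \<theta>0 + \<alpha>0 (X \<omega>) * (Y \<omega> - \<gamma> (X \<omega>)))"
      using assms(11)[OF \<gamma>] int[OF \<gamma>] by simp
    have "(LINT \<omega>|M. m (W \<omega>) \<gamma> - \<theta>0 + \<alpha>0 (X \<omega>) * (Y \<omega> - \<gamma> (X \<omega>)))
        = (LINT \<omega>|M. m (W \<omega>) \<gamma>) - \<theta>0 + (LINT \<omega>|M. \<alpha>0 (X \<omega>) * (Y \<omega> - \<gamma> (X \<omega>)))"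
      using assms(11)[OF \<gamma>] int[OF \<gamma>] by (simp add: prob_space)
    \<comment> \<open>The Riesz identity at \<gamma>0 gives \<theta>0 =
      E[\<alpha>0(X) \<gamma>0(X)], and orthogonality of the residual to \<alpha>0(X) replaces
      \<gamma>0(X) by Y. The Riesz identity at \<gamma> then cancels the remaining terms.\<close>
    moreover have "\<theta>0 = (LINT \<omega>|M. \<alpha>0 (X \<omega>) * Y \<omega>)"
      using orth[OF \<alpha>0 int] eq \<open>\<gamma>0 \<in> \<Gamma>\<close> assms(12,14) by simp
    ultimately show "(LINT \<omega>|M. m (W \<omega>) \<gamma> - \<theta>0 + \<alpha>0 (X \<omega>) * (Y \<omega> - \<gamma> (X \<omega>))) = 0"
      using eq[OF \<gamma>] assms(14)[OF \<gamma>] by simp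
  next
    fix \<alpha> assume \<alpha>: "\<alpha> \<in> borel_measurable S"
      and ex: "integrable M (\<lambda>\<omega>. m (W \<omega>) \<gamma>0 - \<theta>0 + \<alpha> (X \<omega>) * (Y \<omega> - \<gamma>0 (X \<omega>)))"
    have m0: "integrable M (\<lambda>\<omega>. m (W \<omega>) \<gamma>0 - \<theta>0)"
      using assms(11)[OF \<open>\<gamma>0 \<in> \<Gamma>\<close>] by simp
    \<comment> \<open>Subtracting the integrable part m(W,\<gamma>0) - \<theta>0 from the whole
      moment leaves the residual term, so existence of the moment is all that is required of a
      measurable \<alpha>.\<close>
    have int: "integrable M (\<lambda>\<omega>. \<alpha> (X \<omega>) * (Y \<omega> - \<gamma>0 (X \<omega>)))"
      using Bochner_Integration.integrable_diff[OF ex m0] by simp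
    show "(LINT \<omega>|M. m (W \<omega>) \<gamma>0 - \<theta>0 + \<alpha> (X \<omega>) * (Y \<omega> - \<gamma>0 (X \<omega>))) = 0"
      using Bochner_Integration.integral_add[OF m0 int] orth[OF \<alpha> int]
        assms(11)[OF \<open>\<gamma>0 \<in> \<Gamma>\<close>] assms(12)
      by (simp add: prob_space)
  qed
qed

end
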